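(* For every real $R$ with $2\sqrt3-2<R<2$ and every sufficiently small real $\epsilon>0$, the competitive ratio of the proportional\&removable online knapsack problem with a buffer of capacity $R$ is at least $\frac{2}{R}-\epsilon$.
   Context: Online knapsack problem with a resource buffer: there is a knapsack of capacity $1$ and a buffer of capacity $R\ge 1$. Items $e_1,\dots,e_n$ arrive one by one; each item $e$ has size $0<s(e)\le 1$ and value $v(e)\ge 0$; $s(B),v(B)$ denote sums over a set $B$. A deterministic online algorithm maintains buffer contents $B_0=\emptyset,B_1,\dots,B_n$, with $B_i$ chosen after seeing only $e_1,\dots,e_i$, $B_i\subseteq B_{i-1}\cup\{e_i\}$ and $s(B_i)\le R$ (removable setting). $\mathrm{ALG}(I)=\max\{v(B)\mid B\subseteq B_n,\ s(B)\le 1\}$, $\mathrm{OPT}(I)=\max\{v(B)\mid B\subseteq\{e_1,\dots,e_n\},\ s(B)\le 1\}$. "Proportional" means $v(e)=s(e)$ for every item. The competitive ratio of an algorithm is $\sup_I \mathrm{OPT}(I)/\mathrm{ALG}(I)$ (with $a/0=\infty$ for $a>0$), and the competitive ratio of the problem is the infimum of this over all deterministic online algorithms. *)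

theory Defs
  imports Complex_Main "HOL-Library.Extended_Real"
begin

datatype item = Item (item_size: real) (item_value: real)

text \<open>An instance is the list of items in order of arrival. Items are identified with their
  positions in the list, so distinct items may have equal size and value, and sets of items are
  sets of positions.\<close>

type_synonym inst = "item list"

definition valid_instance :: "inst \<Rightarrow> bool" where
  "valid_instance I \<longleftrightarrow>
     (\<forall>e\<in>set I. 0 < item_size e \<and> item_size e \<le> 1 \<and> 0 \<le> item_value e)"

definition proportional :: "inst \<Rightarrow> bool" where
  "proportional I \<longleftrightarrow> (\<forall>e\<in>set I. item_value e = item_size e)"

definition proportional_instances :: "inst set" where
  "proportional_instances = {I. valid_instance I \<and> proportional I}"

definition total_size :: "inst \<Rightarrow> nat set \<Rightarrow> real" where
  "total_size I B = (\<Sum>j\<in>B. item_size (I ! j))"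

definition total_value :: "inst \<Rightarrow> nat set \<Rightarrow> real" where
  "total_value I B = (\<Sum>j\<in>B. item_value (I ! j))"

definition best_packing :: "inst \<Rightarrow> nat set \<Rightarrow> real" where
  "best_packing I S = Max {total_value I B | B. B \<subseteq> S \<and> total_size I B \<le> 1}"

definition OPT :: "inst \<Rightarrow> real" where
  "OPT I = best_packing I {..<length I}"

text \<open>A deterministic online algorithm maps the list of items seen so far to the current buffer
  contents; the number of items still to come is thus unknown to it. It has to respect the rules
  only on inputs from the given class of instances (which should be closed under prefixes).\<close>

type_synonym online_alg = "inst \<Rightarrow> nat set"

definition removable_online_algorithm :: "real \<Rightarrow> inst set \<Rightarrow> online_alg \<Rightarrow> bool" where
  "removable_online_algorithm R \<I> A \<longleftrightarrow>
     A [] = {} \<and>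
     (\<forall>I e. I @ [e] \<in> \<I> \<longrightarrow>
        A (I @ [e]) \<subseteq> A I \<union> {length I} \<and>
        total_size (I @ [e]) (A (I @ [e])) \<le> R)"

definition ALG :: "online_alg \<Rightarrow> inst \<Rightarrow> real" where
  "ALG A I = best_packing I (A I)"

text \<open>Division in \<^typ>\<open>ereal\<close> satisfies \<open>a / 0 = \<infinity>\<close> for \<open>a > 0\<close>, and \<open>0 / 0 = 0\<close>, so that
  instances with optimum \<open>0\<close> do not contribute to the supremum.\<close>

definition algorithm_ratio :: "inst set \<Rightarrow> online_alg \<Rightarrow> ereal" where
  "algorithm_ratio \<I> A = (SUP I\<in>\<I>. ereal (OPT I) / ereal (ALG A I))"

definition removable_competitive_ratio :: "real \<Rightarrow> inst set \<Rightarrow> ereal" where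
  "removable_competitive_ratio R \<I> =
     (INF A\<in>{A. removable_online_algorithm R \<I> A}. algorithm_ratio \<I> A)"

end

theory Submission
  imports Defs
begin

text \<open>
  Put \<open>h = R / 2\<close>; the algorithm has to be kept from packing more than \<open>h + \<delta>\<close>. The adversary
  presents \<open>h\<close>, \<open>h\<^sup>2\<close> and \<open>2h - 1\<close>, which do not fit into the buffer together, and reacts to a
  missing item.
  \<^item> \<open>2h - 1\<close> is missing: its complement \<open>2 - 2h\<close> to the knapsack capacity completes an optimal
    packing of size \<open>1\<close>, while it does not fit with any other item.
  \<^item> \<open>h\<close> is missing: \<open>h + \<delta>\<close> arrives. If it is rejected, the algorithm is left with \<open>h\<^sup>2\<close>.
    If \<open>h\<^sup>2\<close> is dropped, the complement \<open>1 - h\<close> follows, which does not fit with \<open>h + \<delta>\<close>; if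
    \<open>2h - 1\<close> is dropped, its complement follows.
  \<^item> \<open>h\<^sup>2\<close> is missing: \<open>1 - h + \<delta>\<close> arrives, so that again one of three items must go, and the
    complement of a missing item follows: \<open>1 - h\<close>, \<open>1 - h\<^sup>2\<close> or \<open>h - \<delta>\<close>.

  The assumption on \<open>R\<close> says \<open>h\<^sup>2 + 2h > 2\<close>. It is what makes \<open>h\<^sup>2\<close> and \<open>2h - 1\<close> exceed the
  capacity, and what keeps \<open>(1 - h\<^sup>2) + (1 - h)\<close> below \<open>h\<close>.
\<close>

definition prop_inst :: "real list \<Rightarrow> inst" where
  "prop_inst ss = map (\<lambda>s. Item s s) ss"

lemma prop_inst_in_proportional_instances:
  assumes "\<forall>s\<in>set ss. 0 < s \<and> s \<le> 1"
  shows "prop_inst ss \<in> proportional_instances"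
  using assms
  by (auto simp: prop_inst_def proportional_instances_def valid_instance_def proportional_def)

lemma total_size_prop_inst:
  assumes "B \<subseteq> {..<length ss}"
  shows "total_size (prop_inst ss) B = (\<Sum>j\<in>B. ss ! j)"
  unfolding total_size_def prop_inst_def using assms by (intro sum.cong) auto

lemma total_value_prop_inst:
  assumes "B \<subseteq> {..<length ss}"
  shows "total_value (prop_inst ss) B = (\<Sum>j\<in>B. ss ! j)"
  unfolding total_value_def prop_inst_def using assms by (intro sum.cong) auto

lemma finite_packing_values:
  assumes "finite S"
  shows "finite {total_value I B | B. B \<subseteq> S \<and> total_size I B \<le> 1}"
  by (rule finite_subset[of _ "total_value I ` Pow S"]) (use assms in auto)

lemma best_packing_ge:
  assumes "finite S" "B \<subseteq> S" "total_size I B \<le> 1"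
  shows "total_value I B \<le> best_packing I S"
  unfolding best_packing_def
  using assms by (intro Max_ge finite_packing_values) auto

lemma best_packing_nonneg:
  assumes "finite S"
  shows "0 \<le> best_packing I S"
  using best_packing_ge[OF assms, of "{}" I] by (simp add: total_size_def total_value_def)

lemma best_packing_le:
  assumes "finite S" "\<And>B. B \<subseteq> S \<Longrightarrow> total_size I B \<le> 1 \<Longrightarrow> total_value I B \<le> c"
  shows "best_packing I S \<le> c"
proof -
  have "{} \<subseteq> S \<and> total_size I {} \<le> 1" by (simp add: total_size_def)
  then show ?thesis
    unfolding best_packing_def
    by (subst Max_le_iff) (use assms finite_packing_values in blast)+
qed

text \<open>Arguing by contradiction turns every leaf of the adversary's decision tree into the goal
  \<open>False\<close>, closed by \<open>loss\<close>. The product form of the bound also covers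
  \<open>ALG A I = 0\<close>.\<close>

lemma removable_online_algorithm_bounded_by_losing_instance:
  fixes h \<delta> :: real
  assumes A: "removable_online_algorithm (2 * h) proportional_instances A"
    and h: "h < 1" "2 < h\<^sup>2 + 2 * h"
    and \<delta>: "0 < \<delta>" "\<delta> < (1 - h) / 2" and "0 < h"
  shows "\<exists>I\<in>proportional_instances.
    0 < OPT I \<and> 0 \<le> ALG A I \<and> ALG A I \<le> (h + \<delta>) * OPT I"
proof (rule ccontr)
  assume no_loss: "\<not> ?thesis"
  define buf where "buf ss = A (prop_inst ss)" for ss
  define valid where "valid ss \<longleftrightarrow> (\<forall>s\<in>set ss. 0 < s \<and> s \<le> 1)" for ss :: "real list"
  have buf_Nil: "buf [] = {}"
    using A by (simp add: buf_def removable_online_algorithm_def prop_inst_def)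
  \<comment> \<open>Only a superset \<open>S\<close> of the buffer is tracked, since the algorithm
    may discard more than it must.\<close>
  have buf_step: "buf (ss @ [s]) \<subseteq> insert (length ss) S"
    if "valid (ss @ [s])" "buf ss \<subseteq> S" for ss s S
  proof -
    have "prop_inst ss @ [Item s s] \<in> proportional_instances"
      using prop_inst_in_proportional_instances[of "ss @ [s]"] that(1)
      by (simp add: valid_def prop_inst_def)
    then have "A (prop_inst ss @ [Item s s]) \<subseteq> A (prop_inst ss) \<union> {length (prop_inst ss)}"
      using A unfolding removable_online_algorithm_def by blast
    then show ?thesis using that(2) by (auto simp: buf_def prop_inst_def)
  qed
  have buf_size: "total_size (prop_inst (ss @ [s])) (buf (ss @ [s])) \<le> 2 * h"
    if "valid (ss @ [s])" for ss s
    using A prop_inst_in_proportional_instances[of "ss @ [s]"] that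
    by (auto simp: buf_def valid_def removable_online_algorithm_def prop_inst_def)
  have overfull: "\<exists>k\<in>S. buf (ss @ [s]) \<subseteq> S - {k}"
    if "valid (ss @ [s])" "buf (ss @ [s]) \<subseteq> S" "S \<subseteq> {..<length (ss @ [s])}"
      "2 * h < (\<Sum>j\<in>S. (ss @ [s]) ! j)" for ss s S
  proof -
    have "buf (ss @ [s]) \<noteq> S"
      using buf_size[OF that(1)] that(3,4) total_size_prop_inst[of S "ss @ [s]"] by auto
    then show ?thesis using that(2) by blast
  qed
  \<comment> \<open>The packing \<open>T\<close> shows that the optimum is at least
    \<open>t\<close>. In each use, the packings from \<open>S\<close> are checked by enumerating its
    subsets with \<open>Pow_insert\<close>.\<close>
  have loss: False
    if v: "valid ss" and S: "buf ss \<subseteq> S" "S \<subseteq> {..<length ss}"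
      and T: "T \<subseteq> {..<length ss}" "(\<Sum>j\<in>T. ss ! j) = t" "0 < t" "t \<le> 1"
      and B: "\<forall>B\<in>Pow S. (\<Sum>j\<in>B. ss ! j) \<le> 1 \<longrightarrow> (\<Sum>j\<in>B. ss ! j) \<le> (h + \<delta>) * t"
    for ss S T t
  proof -
    have fin: "finite (buf ss)" using S by (meson finite_lessThan finite_subset)
    have "t \<le> OPT (prop_inst ss)"
      using best_packing_ge[of "{..<length ss}" T "prop_inst ss"] T
        total_size_prop_inst[of T ss] total_value_prop_inst[of T ss]
      by (simp add: OPT_def prop_inst_def)
    moreover have "ALG A (prop_inst ss) \<le> (h + \<delta>) * t"
      unfolding ALG_def buf_def[symmetric]
    proof (rule best_packing_le[OF fin])
      fix B' assume B': "B' \<subseteq> buf ss" "total_size (prop_inst ss) B' \<le> 1"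
      then have "B' \<subseteq> {..<length ss}" "B' \<in> Pow S" using S by auto
      then show "total_value (prop_inst ss) B' \<le> (h + \<delta>) * t"
        using B B'(2) total_size_prop_inst[of B' ss] total_value_prop_inst[of B' ss] by auto
    qed
    moreover have "(h + \<delta>) * t \<le> (h + \<delta>) * OPT (prop_inst ss)"
      using calculation(1) \<open>0 < h\<close> \<delta> by (intro mult_left_mono) auto
    moreover have "0 \<le> ALG A (prop_inst ss)"
      using best_packing_nonneg[OF fin] by (simp add: ALG_def buf_def)
    ultimately show False
      using no_loss prop_inst_in_proportional_instances[of ss] v T(3)
      by (fastforce simp: valid_def)
  qed

  \<comment> \<open>At \<open>5 / 7\<close> the terms \<open>3 * h - 2\<close> and
    \<open>(1 - h) / 2\<close> agree. Above it, \<open>\<delta> < 3 * h - 2\<close>, so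
    \<open>2 * h - 1\<close> and \<open>h - \<delta>\<close> do not fit together.\<close>
  have h_lower: "5 / 7 < h"
  proof (rule ccontr)
    assume "\<not> ?thesis"
    then have "h\<^sup>2 \<le> (5 / 7)\<^sup>2" using \<open>0 < h\<close> by (intro power_mono) auto
    with \<open>\<not> ?thesis\<close> h show False by (simp add: power2_eq_square)
  qed
  \<comment> \<open>The second inequality keeps \<open>2 - 2 * h\<close> from fitting together with
    \<open>h\<^sup>2\<close>.\<close>
  have sq: "h\<^sup>2 < h" "2 * h - 1 < h\<^sup>2"
  proof -
    show "h\<^sup>2 < h" using h \<open>0 < h\<close> by (simp add: power2_eq_square)
    have "0 < (1 - h)\<^sup>2" using h by simp
    then show "2 * h - 1 < h\<^sup>2" by (simp add: power2_eq_square algebra_simps)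
  qed
  note bounds = h \<delta> h_lower sq

  let ?L = "[h, h\<^sup>2, 2 * h - 1]"
  have "buf [h] \<subseteq> {0}"
    using buf_step[of "[]" h "{}"] buf_Nil bounds by (simp add: valid_def)
  then have "buf [h, h\<^sup>2] \<subseteq> {0, 1}"
    using buf_step[of "[h]" "h\<^sup>2" "{0}"] bounds by (auto simp: valid_def)
  then have L: "buf ?L \<subseteq> {0, 1, 2}"
    using buf_step[of "[h, h\<^sup>2]" "2 * h - 1" "{0, 1}"] bounds by (auto simp: valid_def)
  have "\<exists>k\<in>{0, 1, 2}. buf ?L \<subseteq> {0, 1, 2} - {k}"
    using overfull[of "[h, h\<^sup>2]" "2 * h - 1" "{0, 1, 2}"] L bounds by (simp add: valid_def)
  moreover have "{0, 1, 2} - {0} = {1, 2::nat}" "{0, 1, 2} - {1} = {0, 2::nat}"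
    "{0, 1, 2} - {2} = {0, 1::nat}" by auto
  ultimately consider "buf ?L \<subseteq> {1, 2}" | "buf ?L \<subseteq> {0, 2}" | "buf ?L \<subseteq> {0, 1}" by auto
  then show False
  proof cases
    case 1
    let ?M = "?L @ [h + \<delta>]"
    have vM: "valid ?M" using bounds by (simp add: valid_def)
    have "buf ?M \<subseteq> {1, 2, 3}" using buf_step[OF vM 1] by auto
    then have "\<exists>k\<in>{1, 2, 3}. buf ?M \<subseteq> {1, 2, 3} - {k}"
      using bounds by (intro overfull[OF vM]) auto
    moreover have "{1, 2, 3} - {1} = {2, 3::nat}" "{1, 2, 3} - {2} = {1, 3::nat}"
      "{1, 2, 3} - {3} = {1, 2::nat}" by auto
    ultimately consider "buf ?M \<subseteq> {2, 3}" | "buf ?M \<subseteq> {1, 3}" | "buf ?M \<subseteq> {1, 2}" by auto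
    then show False
    proof cases
      case 1
      have v: "valid (?M @ [1 - h])" using bounds by (simp add: valid_def)
      show False
        by (rule loss[OF v buf_step[OF v 1], where T = "{0, 4}" and t = 1])
          (use bounds in \<open>auto simp: Pow_insert\<close>)
    next
      case 2
      have v: "valid (?M @ [2 - 2 * h])" using bounds by (simp add: valid_def)
      show False
        by (rule loss[OF v buf_step[OF v 2], where T = "{2, 4}" and t = 1])
          (use bounds in \<open>auto simp: Pow_insert\<close>)
    next
      case 3
      \<comment> \<open>The rejected item alone is the comparison packing, so the target is
        \<open>(h + \<delta>)\<^sup>2\<close>; this is why the second item has size
        \<open>h\<^sup>2\<close>.\<close>
      have "h * h \<le> (h + \<delta>) * (h + \<delta>)" using bounds by (intro mult_mono) auto
      then show False
        by (intro loss[OF vM 3, where T = "{3}" and t = "h + \<delta>"])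
          (use bounds in \<open>auto simp: Pow_insert power2_eq_square\<close>)
    qed
  next
    case 2
    let ?M = "?L @ [1 - h + \<delta>]"
    have vM: "valid ?M" using bounds by (simp add: valid_def)
    have "buf ?M \<subseteq> {0, 2, 3}" using buf_step[OF vM 2] by auto
    \<comment> \<open>The three sizes add up to \<open>2 * h + \<delta>\<close>: the surplus
      \<open>\<delta>\<close> in the new item is what overfills the buffer.\<close>
    then have "\<exists>k\<in>{0, 2, 3}. buf ?M \<subseteq> {0, 2, 3} - {k}"
      using bounds by (intro overfull[OF vM]) auto
    moreover have "{0, 2, 3} - {0} = {2, 3::nat}" "{0, 2, 3} - {2} = {0, 3::nat}"
      "{0, 2, 3} - {3} = {0, 2::nat}" by auto
    ultimately consider "buf ?M \<subseteq> {2, 3}" | "buf ?M \<subseteq> {0, 3}" | "buf ?M \<subseteq> {0, 2}" by auto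
    then show False
    proof cases
      case 1
      have v: "valid (?M @ [1 - h])" using bounds by (simp add: valid_def)
      show False
        by (rule loss[OF v buf_step[OF v 1], where T = "{0, 4}" and t = 1])
          (use bounds in \<open>auto simp: Pow_insert\<close>)
    next
      case 2
      \<comment> \<open>The packing of \<open>1 - h + \<delta>\<close> with
        \<open>1 - h\<^sup>2\<close> stays within \<open>h + \<delta>\<close> because
        \<open>2 < h\<^sup>2 + 2 * h\<close>.\<close>
      have v: "valid (?M @ [1 - h\<^sup>2])" using bounds by (simp add: valid_def)
      show False
        by (rule loss[OF v buf_step[OF v 2], where T = "{1, 4}" and t = 1])
          (use bounds in \<open>auto simp: Pow_insert\<close>)
    next
      case 3
      have v: "valid (?M @ [h - \<delta>])" using bounds by (simp add: valid_def)
      show False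
        by (rule loss[OF v buf_step[OF v 3], where T = "{3, 4}" and t = 1])
          (use bounds in \<open>auto simp: Pow_insert\<close>)
    qed
  next
    case 3
    have v: "valid (?L @ [2 - 2 * h])" using bounds by (simp add: valid_def)
    show False
      by (rule loss[OF v buf_step[OF v 3], where T = "{2, 3}" and t = 1])
        (use bounds in \<open>auto simp: Pow_insert\<close>)
  qed
qed

theorem theorem15:
  fixes R :: real
  assumes "2 * sqrt 3 - 2 < R" and "R < 2"
  shows "\<exists>\<epsilon>\<^sub>0>0. \<forall>\<epsilon>::real. 0 < \<epsilon> \<and> \<epsilon> < \<epsilon>\<^sub>0 \<longrightarrow>
           ereal (2 / R - \<epsilon>) \<le> removable_competitive_ratio R proportional_instances"
\<comment> \<open>This threshold is \<open>(1 - h) / 2\<close>, the bound required of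
  \<open>\<delta>\<close>, which will be smaller than \<open>\<epsilon>\<close>.\<close>
proof (intro exI[of _ "(1 - R / 2) / 2"] conjI allI impI)
  show "0 < (1 - R / 2) / 2" using assms by simp
  fix \<epsilon> :: real
  assume \<epsilon>: "0 < \<epsilon> \<and> \<epsilon> < (1 - R / 2) / 2"
  define h where "h = R / 2"
  \<comment> \<open>With this choice the terms linear in \<open>\<epsilon>\<close> cancel in
    \<open>(1 / h - \<epsilon>) * (h + \<delta>)\<close>.\<close>
  define \<delta> where "\<delta> = \<epsilon> * h\<^sup>2"
  have "1 < sqrt (3::real)" by simp
  then have "0 < R" using assms by linarith
  then have h: "0 < h" "h < 1" using assms by (auto simp: h_def)
  \<comment> \<open>The number \<open>sqrt 3 - 1\<close> is the positive root of
    \<open>h\<^sup>2 + 2 * h = 2\<close>.\<close>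
  have "sqrt 3 < h + 1" using assms by (simp add: h_def)
  then have "(sqrt 3)\<^sup>2 < (h + 1)\<^sup>2" by (intro power_strict_mono) auto
  then have hsq: "2 < h\<^sup>2 + 2 * h" by (simp add: power2_eq_square algebra_simps)
  have "h\<^sup>2 < 1" using h by (simp add: power_less_one_iff)
  then have "\<delta> < \<epsilon>" using \<epsilon> by (simp add: \<delta>_def)
  moreover have "\<epsilon> < (1 - h) / 2" using \<epsilon> by (simp add: h_def)
  ultimately have \<delta>: "\<delta> < (1 - h) / 2" by linarith
  have \<delta>_pos: "0 < \<delta>" using h \<epsilon> by (simp add: \<delta>_def)
  have ratio: "(2 / R - \<epsilon>) * (h + \<delta>) \<le> 1"
  proof -
    have "(2 / R - \<epsilon>) * (h + \<delta>) = (1 / h - \<epsilon>) * (h + \<epsilon> * h\<^sup>2)"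
      by (simp add: h_def \<delta>_def)
    also have "\<dots> = 1 - (\<epsilon> * h)\<^sup>2"
      using h by (simp add: field_simps power2_eq_square)
    finally show ?thesis by simp
  qed
  show "ereal (2 / R - \<epsilon>) \<le> removable_competitive_ratio R proportional_instances"
    unfolding removable_competitive_ratio_def
  proof (rule INF_greatest)
    fix A assume "A \<in> {A. removable_online_algorithm R proportional_instances A}"
    then have A: "removable_online_algorithm (2 * h) proportional_instances A"
      by (simp add: h_def)
    from removable_online_algorithm_bounded_by_losing_instance[OF A h(2) hsq \<delta>_pos \<delta> h(1)]
    obtain I where I: "I \<in> proportional_instances" "0 < OPT I" "0 \<le> ALG A I" "ALG A I \<le> (h + \<delta>) * OPT I"
      by blast
    have "ereal (2 / R - \<epsilon>) \<le> ereal (OPT I) / ereal (ALG A I)"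
    proof (cases "0 < ALG A I")
      case True
      have "2 / R - \<epsilon> \<ge> 0"
      proof -
        have "\<epsilon> < 1" "1 < 2 / R" using \<epsilon> h by (auto simp: h_def)
        then show ?thesis by simp
      qed
      then have "(2 / R - \<epsilon>) * ALG A I \<le> (2 / R - \<epsilon>) * ((h + \<delta>) * OPT I)"
        using I(4) by (intro mult_left_mono)
      also have "\<dots> \<le> 1 * OPT I"
        using mult_right_mono[OF ratio, of "OPT I"] I(2) by (simp add: mult.assoc)
      finally show ?thesis using True by (simp add: field_simps)
    next
      case False
      then have "ALG A I = 0" using I(3) by simp
      then show ?thesis using I(2) by simp
    qed
    also have "\<dots> \<le> algorithm_ratio proportional_instances A"
      unfolding algorithm_ratio_def using I(1) by (rule SUP_upper)
    finally show "ereal (2 / R - \<epsilon>) \<le> algorithm_ratio proportional_instances A" .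
  qed
qed

end
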